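(* In the RESTART model with task time density $f$, failure time distribution $G$ and total time $X$, let $\mu=1/\mathbb E U$ and define $$I_\pm(x,\epsilon)=\int_0^\infty \exp\bigl\{-\mu\,\overline G(t)\,x\,(1\pm\epsilon)\bigr\}\,f(t)\,dt .$$ Then for each $\epsilon>0$, $$1-\epsilon\ \le\ \liminf_{x\to\infty}\frac{\overline H(x)}{I_+(x,\epsilon)}\ \le\ \limsup_{x\to\infty}\frac{\overline H(x)}{I_-(x,\epsilon)}\ \le\ 1+\epsilon .$$
   Context: RESTART model: $T$ is a nonnegative random variable (task time) with distribution $F$ having density $f$. $U,U_1,U_2,\ldots$ are nonnegative i.i.d. random variables (failure times) with distribution $G$ having density $g$, independent of $T$. $N=\inf\{n\ge 0:\,U_{n+1}>T\}$, $S=\sum_{i=1}^N U_i$, and the total time is $X=T+S$, with distribution $H$. Write $\overline G(t)=\mathbb P(U>t)$ and $\overline H(x)=\mathbb P(X>x)$. It is assumed that $\mu>0$ and that the support of $F$ is unbounded.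
   Formalization: The middle inequality (liminf of H̄/I₊ at most limsup of H̄/I₋) is omitted because it is false: for T, U exponential(1) and 0<ε<1 the ratios tend to 1+ε and 1−ε. Only the two outer bounds, by 1−ε and 1+ε, are stated and proved, for every ε>0. *)

theory Defs
  imports "HOL-Probability.Probability"
begin

definition measure_support :: "'a::topological_space measure \<Rightarrow> 'a set" where
  "measure_support D = {x. \<forall>V. open V \<longrightarrow> x \<in> V \<longrightarrow> 0 < emeasure D V}"

text \<open>
  The variables \<open>U\<close>, \<open>U\<^sub>1\<close>, \<open>U\<^sub>2\<close>, \<dots> form one sequence: \<open>U 0\<close> is the generic failure time,
  and \<open>U 1\<close>, \<open>U 2\<close>, \<dots> are the failure times entering the total time.

  If \<open>U\<close> is bounded, then \<open>U\<^sub>n\<^sub>+\<^sub>1 > T\<close> may fail for all \<open>n\<close> with positive probability. The number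
  of restarts is therefore an extended natural number (the infimum of the empty set is \<open>\<infinity>\<close>), and
  \<open>S\<close> and \<open>X\<close> take values in \<open>[0, \<infinity>]\<close>. The truncation by \<^const>\<open>ennreal\<close> is
  immaterial since \<open>T\<close> and \<open>U n\<close> are almost surely nonnegative.
\<close>

definition restart_N :: "('a \<Rightarrow> real) \<Rightarrow> (nat \<Rightarrow> 'a \<Rightarrow> real) \<Rightarrow> 'a \<Rightarrow> enat" where
  "restart_N T U \<omega> = Inf {enat n |n. U (Suc n) \<omega> > T \<omega>}"

definition restart_S :: "('a \<Rightarrow> real) \<Rightarrow> (nat \<Rightarrow> 'a \<Rightarrow> real) \<Rightarrow> 'a \<Rightarrow> ennreal" where
  "restart_S T U \<omega> =
     (\<Sum>i. if 1 \<le> i \<and> enat i \<le> restart_N T U \<omega> then ennreal (U i \<omega>) else 0)"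

definition restart_X :: "('a \<Rightarrow> real) \<Rightarrow> (nat \<Rightarrow> 'a \<Rightarrow> real) \<Rightarrow> 'a \<Rightarrow> ennreal" where
  "restart_X T U \<omega> = ennreal (T \<omega>) + restart_S T U \<omega>"

definition restart_Gbar :: "'a measure \<Rightarrow> (nat \<Rightarrow> 'a \<Rightarrow> real) \<Rightarrow> real \<Rightarrow> real" where
  "restart_Gbar M U t = measure M {\<omega> \<in> space M. U 0 \<omega> > t}"

definition restart_Hbar ::
    "'a measure \<Rightarrow> ('a \<Rightarrow> real) \<Rightarrow> (nat \<Rightarrow> 'a \<Rightarrow> real) \<Rightarrow> real \<Rightarrow> real" where
  "restart_Hbar M T U x = measure M {\<omega> \<in> space M. restart_X T U \<omega> > ennreal x}"

definition restart_mu :: "'a measure \<Rightarrow> (nat \<Rightarrow> 'a \<Rightarrow> real) \<Rightarrow> real" where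
  "restart_mu M U = 1 / integral\<^sup>L M (U 0)"

definition restart_I_plus ::
    "'a measure \<Rightarrow> (nat \<Rightarrow> 'a \<Rightarrow> real) \<Rightarrow> (real \<Rightarrow> real) \<Rightarrow> real \<Rightarrow> real \<Rightarrow> real" where
  "restart_I_plus M U f x \<epsilon> =
     (LINT t:{0..}|lborel. exp (- (restart_mu M U * restart_Gbar M U t * x * (1 + \<epsilon>))) * f t)"

definition restart_I_minus ::
    "'a measure \<Rightarrow> (nat \<Rightarrow> 'a \<Rightarrow> real) \<Rightarrow> (real \<Rightarrow> real) \<Rightarrow> real \<Rightarrow> real \<Rightarrow> real" where
  "restart_I_minus M U f x \<epsilon> =
     (LINT t:{0..}|lborel. exp (- (restart_mu M U * restart_Gbar M U t * x * (1 - \<epsilon>))) * f t)"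

locale restart_model = prob_space M
  for M :: "'a measure" and T :: "'a \<Rightarrow> real" and U :: "nat \<Rightarrow> 'a \<Rightarrow> real"
    and f g :: "real \<Rightarrow> real" +
  assumes T_nonneg: "AE \<omega> in M. 0 \<le> T \<omega>"
    and U_nonneg: "\<And>n. AE \<omega> in M. 0 \<le> U n \<omega>"
    and f_nonneg: "\<And>t. 0 \<le> f t"
    and g_nonneg: "\<And>t. 0 \<le> g t"
    and T_density: "distributed M lborel T (\<lambda>t. ennreal (f t))"
    and U_density: "\<And>n. distributed M lborel (U n) (\<lambda>t. ennreal (g t))"
    and indep: "indep_vars (\<lambda>_. borel) (case_nat T U) UNIV"
    and mu_pos: "0 < restart_mu M U"
    and T_unbounded: "\<not> bounded (measure_support (distr M borel T))"
begin

text \<open>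
  The family \<open>case_nat T U\<close> is \<open>T\<close>, \<open>U 0\<close>, \<open>U 1\<close>, \<dots>: the \<open>U n\<close> are independent, and
  the whole sequence is independent of \<open>T\<close>.

  Since the Bochner integral is \<open>0\<close> on non-integrable functions, an infinite mean gives
  \<open>\<mu> = 0\<close>, as with the usual convention \<open>1 / \<infinity> = 0\<close>; so \<open>mu_pos\<close> says that the mean is finite.
\<close>

lemma integrable_U0: "integrable M (U 0)"
  using mu_pos not_integrable_integral_eq[of M "U 0"] by (auto simp: restart_mu_def)

end

end

theory Submission
  imports Defs "HOL-Real_Asymp.Real_Asymp"
begin

text \<open>
Condition on the task time \<open>T = t\<close>. The time spent in failed attempts is then a sum of i.i.d. failure
times, killed at the first one that exceeds \<open>t\<close>, and its tail decays at the rate \<open>\<gamma>(t)\<close> solving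
\<open>E[exp (\<gamma> U); U \<le> t] = 1\<close>. To first order the left side is \<open>1 - P(U > t) + \<gamma> E[U; U \<le> t]\<close>, so for large
\<open>t\<close> the rate is about \<open>\<mu> P(U > t)\<close>. For \<open>\<epsilon> < 1\<close> it lies between \<open>\<theta>\<^sub>- = \<mu> P(U > t) (1 - \<epsilon>)\<close> and
\<open>\<theta>\<^sub>+ = \<mu> P(U > t) (1 + \<epsilon>)\<close>. The proof compares directly with these two rates instead of with
\<open>\<gamma>\<close>: the truncated exponential moment is at most \<open>1\<close> at \<open>\<theta>\<^sub>-\<close> and at least \<open>1\<close> at \<open>\<theta>\<^sub>+\<close> (\<open>moment_le_1\<close>, \<open>moment_ge_1\<close>),
and each of these inequalities turns an exponential function into a super- or subsolution of the
renewal equation for the tail (\<open>failed_tail_le\<close>, \<open>failed_tail_ge\<close>). In the lower bound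
the overshoot over a level is at most \<open>t\<close> and cancels against the task time itself, whence, for \<open>t\<close>
beyond some \<open>s\<close>,

  \<open>exp (- \<theta>\<^sub>+ x) \<le> P(X > x | T = t) \<le> exp (- \<theta>\<^sub>- (x - t))\<close>.

The remaining factor \<open>exp (\<theta>\<^sub>- t)\<close> is close to \<open>1\<close> for large \<open>t\<close> because \<open>t P(U > t) \<le> E[U; U > t]\<close>, which
tends to \<open>0\<close> as the mean is finite. This makes the upper bound sharp even for task times of the order
of \<open>x\<close> or larger. (For \<open>\<epsilon> \<ge> 1\<close> the upper estimate is immediate, since then \<open>I\<^sub>- \<ge> 1\<close>.)

Integrating over \<open>t \<ge> s\<close> gives the integrals \<open>I\<^sub>\<plusminus>\<close> up to the part coming from \<open>t < s\<close>, which is at most of order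
\<open>exp (- \<mu> P(U > s) (1 \<plusminus> \<epsilon>) x)\<close>. This is negligible (\<open>exp_rate_negligible\<close>), since longer task times,
which have positive probability, decay more slowly. For this the level \<open>s\<close> must satisfy \<open>P(U > s) > 0\<close>
although \<open>E[U; U > s]\<close> is small, also when \<open>U\<close> is bounded; \<open>mean_above_attains\<close> provides it.
\<close>

section \<open>The time spent in failed attempts\<close>

text \<open>
The entries of \<open>\<omega>\<close> are the successive failure times of a task of length \<open>t\<close>. An attempt fails if its
entry is at most \<open>t\<close>; all entries from the first successful attempt on are dropped. Only the first
\<open>n\<close> attempts count, so that the value is a real number even if no attempt ever succeeds.
\<close>

definition failed_time :: "nat \<Rightarrow> real \<Rightarrow> (nat \<Rightarrow> real) \<Rightarrow> real" where
  "failed_time n t \<omega> = (\<Sum>i<n. if \<forall>j\<le>i. \<omega> j \<le> t then \<omega> i else 0)"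

text \<open>
After a failed first attempt the process starts afresh. The exponential bounds rest
on this renewal identity.
\<close>

lemma failed_time_case_nat:
  "failed_time (Suc n) t (case_nat u \<omega>) = (if u \<le> t then u + failed_time n t \<omega> else 0)"
proof -
  have first: "(\<forall>j\<le>Suc i. case_nat u \<omega> j \<le> t) \<longleftrightarrow> u \<le> t \<and> (\<forall>j\<le>i. \<omega> j \<le> t)" for i
    by (simp add: All_less_Suc2 flip: less_Suc_eq_le)
  have "failed_time (Suc n) t (case_nat u \<omega>)
      = (if u \<le> t then u else 0) + (\<Sum>i<n. if u \<le> t \<and> (\<forall>j\<le>i. \<omega> j \<le> t) then \<omega> i else 0)"
    unfolding failed_time_def sum.lessThan_Suc_shift first nat.case by simp
  then show ?thesis
    by (simp add: failed_time_def)
qed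

lemma measurable_failed_time [measurable (raw)]:
  assumes [measurable]: "t \<in> borel_measurable A" "\<And>i. (\<lambda>a. X a i) \<in> borel_measurable A"
  shows "(\<lambda>a. failed_time n (t a) (X a)) \<in> borel_measurable A"
  unfolding failed_time_def by measurable

section \<open>Exponential bounds for a sequence of failure times\<close>

text \<open>
Atoms are excluded in order to make the truncated means continuous in the truncation level, which
\<open>mean_above_attains\<close> needs.
\<close>

locale failure_law = prob_space D for D :: "real measure" +
  assumes sets_law [measurable_cong, simp]: "sets D = sets borel"
    and nonneg: "AE u in D. 0 \<le> u"
    and integrable_id: "integrable D (\<lambda>u. u)"
    and integral_pos: "0 < (\<integral>u. u \<partial>D)"
    and atomless: "emeasure D {a} = 0"
begin

sublocale seq: sequence_space D
  by unfold_locales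

lemma space_law [simp]: "space D = UNIV"
  using sets_eq_imp_space_eq[OF sets_law] by simp

definition failed_tail :: "nat \<Rightarrow> real \<Rightarrow> real \<Rightarrow> ennreal" where
  "failed_tail n t y = emeasure seq.S {\<omega> \<in> space seq.S. y < failed_time n t \<omega>}"

lemma measurable_failed_tail [measurable (raw)]:
  assumes [measurable]: "t \<in> borel_measurable A" "y \<in> borel_measurable A"
  shows "(\<lambda>a. failed_tail n (t a) (y a)) \<in> borel_measurable A"
  unfolding failed_tail_def by measurable

text \<open>
Since \<open>D\<close> times the sequence law is again the sequence law, conditioning on the first failure time
turns \<open>failed_time_case_nat\<close> into a renewal equation. For \<open>y < 0\<close> it would miss the event that the
first attempt succeeds, in which case the failed time is \<open>0 > y\<close>.
\<close>

lemma failed_tail_Suc: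
  assumes "0 \<le> y"
  shows "failed_tail (Suc n) t y = (\<integral>\<^sup>+u. indicator {..t} u * failed_tail n t (y - u) \<partial>D)"
proof -
  have [measurable]: "{\<omega> \<in> space seq.S. y < failed_time (Suc n) t \<omega>} \<in> sets seq.S"
    by measurable
  have "failed_tail (Suc n) t y = emeasure (distr (D \<Otimes>\<^sub>M seq.S) seq.S (\<lambda>(s, \<omega>). case_nat s \<omega>))
          {\<omega> \<in> space seq.S. y < failed_time (Suc n) t \<omega>}"
    by (simp add: failed_tail_def seq.PiM_iter)
  also have "\<dots> = emeasure (D \<Otimes>\<^sub>M seq.S)
      {p \<in> space (D \<Otimes>\<^sub>M seq.S). y < failed_time (Suc n) t (case_nat (fst p) (snd p))}"
    by (subst emeasure_distr, measurable)
       (auto intro!: arg_cong2[where f = emeasure] simp: space_pair_measure space_PiM split_beta')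
  also have "\<dots> = (\<integral>\<^sup>+u. emeasure seq.S
      {\<omega> \<in> space seq.S. y < failed_time (Suc n) t (case_nat u \<omega>)} \<partial>D)"
    by (subst seq.P.emeasure_pair_measure_alt)
       (auto intro!: nn_integral_cong arg_cong2[where f=emeasure] simp: space_pair_measure)
  also have "\<dots> = (\<integral>\<^sup>+u. indicator {..t} u * failed_tail n t (y - u) \<partial>D)"
    using assms
    by (intro nn_integral_cong)
       (auto simp: failed_time_case_nat failed_tail_def indicator_def less_diff_eq algebra_simps)
  finally show ?thesis .
qed

text \<open>
A Chernoff bound for the stopped random walk, proved through the renewal equation: the right-hand
side \<open>exp (- \<theta> y)\<close> is at least \<open>1\<close> for negative \<open>y\<close>, and the moment hypothesis says exactly that it is
a supersolution of \<open>failed_tail_Suc\<close>.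
\<close>

lemma failed_tail_le:
  assumes "0 \<le> \<theta>" and moment: "(\<integral>\<^sup>+u. indicator {..t} u * ennreal (exp (\<theta> * u)) \<partial>D) \<le> 1"
  shows "failed_tail n t y \<le> ennreal (exp (- \<theta> * y))"
proof (induction n arbitrary: y)
  case 0
  show ?case
  proof (cases "y < 0")
    case True
    then have "1 \<le> exp (- \<theta> * y)" using \<open>0 \<le> \<theta>\<close> by (simp add: mult_nonneg_nonpos)
    then show ?thesis
      using seq.P.emeasure_space_1 True by (simp add: failed_tail_def failed_time_def)
  qed (simp add: failed_tail_def failed_time_def)
next
  case (Suc n)
  show ?case
  proof (cases "y < 0")
    case True
    then have "1 \<le> exp (- \<theta> * y)" using \<open>0 \<le> \<theta>\<close> by (simp add: mult_nonneg_nonpos)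
    then have "1 \<le> ennreal (exp (- \<theta> * y))" by simp
    moreover have "failed_tail (Suc n) t y \<le> 1" by (simp add: failed_tail_def seq.P.emeasure_le_1)
    ultimately show ?thesis by (rule order_trans[rotated])
  next
    case False
    then have "failed_tail (Suc n) t y = (\<integral>\<^sup>+u. indicator {..t} u * failed_tail n t (y - u) \<partial>D)"
      by (simp add: failed_tail_Suc)
    also have "\<dots> \<le> (\<integral>\<^sup>+u. indicator {..t} u * ennreal (exp (- \<theta> * (y - u))) \<partial>D)"
      by (intro nn_integral_mono mult_left_mono Suc) simp
    also have "\<dots> = (\<integral>\<^sup>+u. ennreal (exp (- \<theta> * y)) * (indicator {..t} u * ennreal (exp (\<theta> * u))) \<partial>D)"
      by (intro nn_integral_cong)
         (auto simp: indicator_def algebra_simps simp flip: ennreal_mult exp_add)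
    also have "\<dots> = ennreal (exp (- \<theta> * y)) * (\<integral>\<^sup>+u. indicator {..t} u * ennreal (exp (\<theta> * u)) \<partial>D)"
      by (rule nn_integral_cmult) measurable
    also have "\<dots> \<le> ennreal (exp (- \<theta> * y)) * 1"
      by (intro mult_left_mono moment) simp
    finally show ?thesis by simp
  qed
qed

text \<open>
The Laplace transform of \<open>D\<close> at \<open>1\<close>. Being less than \<open>1\<close>, it makes the truncation error in
\<open>failed_tail_ge\<close> vanish as the number of attempts grows.
\<close>

definition discount :: real where "discount = (\<integral>u. exp (- u) \<partial>D)"

lemma exp_neg_le_1: "AE u in D. exp (- u) \<le> 1"
  using nonneg by eventually_elim simp

lemma integrable_exp_neg: "integrable D (\<lambda>u. exp (- u))"
  by (rule integrable_const_bound[where B = 1]) (use exp_neg_le_1 in auto)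

lemma discount_nonneg: "0 \<le> discount"
  by (simp add: discount_def)

lemma discount_less_1: "discount < 1"
proof -
  have int: "integrable D (\<lambda>u. 1 - exp (- u))"
    using integrable_exp_neg by simp
  have eq: "(\<integral>u. 1 - exp (- u) \<partial>D) = 1 - discount"
    using integrable_exp_neg by (simp add: discount_def prob_space[unfolded space_law])
  have nn: "AE u in D. 0 \<le> 1 - exp (- u)"
    using exp_neg_le_1 by eventually_elim simp
  have "1 - discount \<noteq> 0"
  proof
    assume "1 - discount = 0"
    then have "AE u in D. 1 - exp (- u) = 0"
      using integral_nonneg_eq_0_iff_AE[OF int nn] eq by simp
    then have "AE u in D. u = 0" by eventually_elim simp
    then have "(\<integral>u. u \<partial>D) = 0" by (rule integral_eq_zero_AE)
    with integral_pos show False by simp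
  qed
  moreover have "0 \<le> 1 - discount"
    using integral_nonneg_AE[OF nn] eq by simp
  ultimately show ?thesis by simp
qed

lemma nn_integral_exp_neg: "(\<integral>\<^sup>+u. ennreal (exp (- u)) \<partial>D) = ennreal discount"
  unfolding discount_def by (intro nn_integral_eq_integral integrable_exp_neg) simp

lemma failed_tail_eq_1:
  assumes "y < 0"
  shows "failed_tail n t y = 1"
proof -
  have "AE \<omega> in seq.S. \<forall>i. 0 \<le> \<omega> i"
    unfolding AE_all_countable
    by (intro allI AE_PiM_component[where P = "\<lambda>u. 0 \<le> u"] nonneg prob_space_axioms) simp
  then have "AE \<omega> in seq.S. y < failed_time n t \<omega>"
  proof eventually_elim
    case (elim \<omega>)
    then have "0 \<le> failed_time n t \<omega>" unfolding failed_time_def by (intro sum_nonneg) auto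
    with assms show ?case by simp
  qed
  then show ?thesis
    unfolding failed_tail_def by (intro seq.P.emeasure_eq_1_AE) measurable
qed

text \<open>
The matching lower bound. Exceeding the level \<open>y\<close> by a jump of size at most \<open>t\<close> costs an overshoot
of at most \<open>t\<close>, so \<open>exp (- \<theta> (y + t))\<close>, which is at most \<open>1\<close> for \<open>- t \<le> y\<close>, is a subsolution of the
renewal equation. The second summand bounds the probability that \<open>n\<close> attempts all fail without
having brought the sum above \<open>y\<close>: it is the Markov bound for \<open>exp (- (\<omega> 0 + \<dots>))\<close>. It is
there because with no attempts left the tail is \<open>0\<close> for \<open>0 \<le> y\<close>, below any exponential.
\<close>

lemma failed_tail_ge:
  assumes "0 \<le> \<theta>" and moment: "1 \<le> (\<integral>\<^sup>+u. indicator {..t} u * ennreal (exp (\<theta> * u)) \<partial>D)"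
  shows "- t \<le> y \<Longrightarrow> ennreal (exp (- \<theta> * (y + t))) \<le> failed_tail n t y + ennreal (exp y * discount ^ n)"
proof (induction n arbitrary: y)
  case 0
  have *: "exp (- \<theta> * (y + t)) \<le> 1"
    using 0 \<open>0 \<le> \<theta>\<close> by simp
  show ?case
  proof (cases "y < 0")
    case True
    then show ?thesis using * by (simp add: failed_tail_eq_1 add_increasing2)
  next
    case False
    then have "exp (- \<theta> * (y + t)) \<le> exp y * discount ^ 0" using *
      by (smt (verit) mult_cancel_left1 one_le_exp_iff power_0)
    then have "ennreal (exp (- \<theta> * (y + t))) \<le> ennreal (exp y * discount ^ 0)"
      by (rule ennreal_leI)
    then show ?thesis by (rule add_increasing[rotated]) simp
  qed
next
  case (Suc n)
  show ?case
  proof (cases "y < 0")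
    case True
    have "exp (- \<theta> * (y + t)) \<le> 1"
      using Suc \<open>0 \<le> \<theta>\<close> by simp
    then show ?thesis using True by (simp add: failed_tail_eq_1 add_increasing2)
  next
    case False
    let ?w = "\<lambda>u. indicator {..t} u :: ennreal"
    have "ennreal (exp (- \<theta> * (y + t))) * 1
        \<le> ennreal (exp (- \<theta> * (y + t))) * (\<integral>\<^sup>+u. ?w u * ennreal (exp (\<theta> * u)) \<partial>D)"
      by (intro mult_left_mono moment) simp
    also have "\<dots> = (\<integral>\<^sup>+u. ennreal (exp (- \<theta> * (y + t))) * (?w u * ennreal (exp (\<theta> * u))) \<partial>D)"
      by (rule nn_integral_cmult[symmetric]) measurable
    also have "\<dots> = (\<integral>\<^sup>+u. ?w u * ennreal (exp (- \<theta> * (y - u + t))) \<partial>D)"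
      by (intro nn_integral_cong)
         (auto simp: indicator_def algebra_simps simp flip: ennreal_mult exp_add)
    also have "\<dots> \<le> (\<integral>\<^sup>+u. ?w u * failed_tail n t (y - u) + ennreal (exp y * discount ^ n) * ennreal (exp (- u)) \<partial>D)"
    proof (intro nn_integral_mono)
      fix u
      show "?w u * ennreal (exp (- \<theta> * (y - u + t)))
          \<le> ?w u * failed_tail n t (y - u) + ennreal (exp y * discount ^ n) * ennreal (exp (- u))"
      proof (cases "u \<le> t")
        case True
        with False have "- t \<le> y - u" by simp
        from Suc.IH[OF this] True show ?thesis
          by (simp add: discount_nonneg exp_diff exp_minus divide_inverse mult_ac flip: ennreal_mult)
      qed simp
    qed
    also have "\<dots> = (\<integral>\<^sup>+u. ?w u * failed_tail n t (y - u) \<partial>D)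
        + ennreal (exp y * discount ^ n) * (\<integral>\<^sup>+u. ennreal (exp (- u)) \<partial>D)"
      by (subst nn_integral_add, measurable) (subst nn_integral_cmult, measurable)
    also have "\<dots> = failed_tail (Suc n) t y + ennreal (exp y * discount ^ Suc n)"
      using False
      by (simp add: failed_tail_Suc nn_integral_exp_neg discount_nonneg mult_ac flip: ennreal_mult)
    finally show ?thesis by simp
  qed
qed

section \<open>Decay rates and truncated means\<close>

definition mean :: real where "mean = (\<integral>u. u \<partial>D)"
definition survival :: "real \<Rightarrow> real" where "survival t = measure D {t<..}"
definition mean_above :: "real \<Rightarrow> real" where "mean_above t = (\<integral>u. indicator {t<..} u * u \<partial>D)"

lemma mean_pos: "0 < mean"
  using integral_pos by (simp add: mean_def)

lemma integrable_indicator_mult_id: "A \<in> sets borel \<Longrightarrow> integrable D (\<lambda>u. indicator A u * u)"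
  using integrable_mult_indicator[OF _ integrable_id, of A] by simp

lemma integrable_indicator [simp]: "A \<in> sets borel \<Longrightarrow> integrable D (indicator A :: real \<Rightarrow> real)"
  by (rule integrable_real_indicator) (auto simp: emeasure_eq_measure)

lemma integral_id_atMost: "(\<integral>u. indicator {..t} u * u \<partial>D) = mean - mean_above t"
proof -
  have "(\<integral>u. indicator {..t} u * u \<partial>D) + mean_above t
      = (\<integral>u. indicator {..t} u * u + indicator {t<..} u * u \<partial>D)"
    unfolding mean_above_def
    by (intro Bochner_Integration.integral_add[symmetric] integrable_indicator_mult_id) auto
  also have "\<dots> = mean"
    unfolding mean_def by (intro Bochner_Integration.integral_cong) (auto simp: indicator_def)
  finally show ?thesis by simp
qed

lemma prob_atMost: "measure D {..t} = 1 - survival t"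
proof -
  have "{..t} = space D - {t<..}" by auto
  then show ?thesis unfolding survival_def using prob_compl[of "{t<..}"] by simp
qed

lemma mean_above_antimono:
  assumes "0 \<le> s" "s \<le> t" shows "mean_above t \<le> mean_above s"
  unfolding mean_above_def
  by (intro integral_mono integrable_indicator_mult_id) (use assms in \<open>auto simp: indicator_def\<close>)

text \<open>
Together with \<open>tendsto_mean_above\<close>, this says that \<open>t\<close> times the survival function tends to \<open>0\<close>. It is
the reason why the length of the task itself, and the overshoot, do not show up in the limit.
\<close>

lemma survival_le_mean_above:
  assumes "0 \<le> t" shows "survival t * t \<le> mean_above t"
proof -
  have "integrable D (\<lambda>u. indicator {t<..} u * t)"
    by (rule integrable_mult_left) simp
  then have "(\<integral>u. indicator {t<..} u * t \<partial>D) \<le> mean_above t"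
    unfolding mean_above_def
    by (rule integral_mono[OF _ integrable_indicator_mult_id]) (auto simp: indicator_def)
  then show ?thesis by (simp add: survival_def integral_mult_left_zero)
qed

lemma survival_antimono: "s \<le> t \<Longrightarrow> survival t \<le> survival s"
  unfolding survival_def by (intro finite_measure_mono) auto

lemma measurable_survival [measurable]: "survival \<in> borel_measurable borel"
proof -
  have "mono (\<lambda>t. - survival t)"
    by (intro monoI) (simp add: survival_antimono)
  then have "(\<lambda>t. - survival t) \<in> borel_measurable borel"
    by (rule borel_measurable_mono)
  then show ?thesis by simp
qed

lemma survival_nonneg: "0 \<le> survival t" and survival_le_1: "survival t \<le> 1"
  by (simp_all add: survival_def)

lemma mean_above_eq_0: "survival t = 0 \<Longrightarrow> mean_above t = 0"
proof -
  assume "survival t = 0"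
  then have "AE u in D. u \<notin> {t<..}"
    by (intro AE_not_in) (simp add: survival_def null_sets_def emeasure_eq_measure)
  then have "AE u in D. indicator {t<..} u * u = 0"
    by eventually_elim auto
  then show ?thesis unfolding mean_above_def by (rule integral_eq_zero_AE)
qed

lemma mean_above_0: "mean_above 0 = mean"
  unfolding mean_above_def mean_def
  by (intro integral_cong_AE) (use nonneg in \<open>auto simp: indicator_def\<close>)

lemma tendsto_mean_above: "(mean_above \<longlongrightarrow> 0) at_top"
proof -
  have "((\<lambda>t. \<integral>u. indicator {t<..} u * u \<partial>D) \<longlongrightarrow> (\<integral>u. 0 \<partial>D)) at_top"
  proof (rule integral_dominated_convergence_at_top[where w = "\<lambda>u. \<bar>u\<bar>"])
    show "AE u in D. ((\<lambda>t. indicator {t<..} u * u) \<longlongrightarrow> 0) at_top"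
    proof (intro AE_I2 tendsto_eventually)
      fix u :: real
      show "\<forall>\<^sub>F t in at_top. indicator {t<..} u * u = 0"
        using eventually_ge_at_top[of u] by eventually_elim simp
    qed
    show "\<forall>\<^sub>F t in at_top. AE u in D. norm (indicator {t<..} u * u) \<le> \<bar>u\<bar>"
      by (intro always_eventually allI AE_I2) (simp add: indicator_def)
    show "integrable D (\<lambda>u. \<bar>u\<bar>)"
      using integrable_id by simp
  qed measurable
  then show ?thesis by (simp add: mean_above_def[abs_def])
qed

lemma tendsto_survival: "(survival \<longlongrightarrow> 0) at_top"
proof (rule tendsto_sandwich[OF _ _ tendsto_const tendsto_mean_above])
  show "\<forall>\<^sub>F t in at_top. survival t \<le> mean_above t"
    using eventually_ge_at_top[of 1]
  proof eventually_elim
    case (elim t)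
    then have "survival t * 1 \<le> survival t * t"
      by (intro mult_left_mono) (auto simp: survival_def)
    also have "\<dots> \<le> mean_above t"
      using elim by (intro survival_le_mean_above) simp
    finally show ?case by simp
  qed
qed (simp add: survival_def)

lemma isCont_mean_above: "isCont mean_above t"
  unfolding continuous_at_sequentially comp_def
proof (intro allI impI)
  fix s assume s: "s \<longlonglongrightarrow> t"
  show "(\<lambda>n. mean_above (s n)) \<longlonglongrightarrow> mean_above t"
    unfolding mean_above_def
  proof (rule integral_dominated_convergence[where w = "\<lambda>u. \<bar>u\<bar>"])
    have "AE u in D. u \<noteq> t"
      using AE_not_in[of "{t}" D] atomless[of t] by (simp add: null_sets_def)
    then show "AE u in D. (\<lambda>n. indicator {s n<..} u * u) \<longlonglongrightarrow> indicator {t<..} u * u"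
    proof eventually_elim
      case (elim u)
      consider "u < t" | "t < u" using elim by linarith
      then show ?case
      proof cases
        case 1
        have "\<forall>\<^sub>F n in sequentially. indicator {s n<..} u * u = indicator {t<..} u * u"
          using order_tendstoD(1)[OF s 1] by eventually_elim (use 1 in auto)
        then show ?thesis by (rule tendsto_eventually)
      next
        case 2
        have "\<forall>\<^sub>F n in sequentially. indicator {s n<..} u * u = indicator {t<..} u * u"
          using order_tendstoD(2)[OF s 2] by eventually_elim (use 2 in auto)
        then show ?thesis by (rule tendsto_eventually)
      qed
    qed
    show "AE u in D. norm (indicator {s n<..} u * u) \<le> \<bar>u\<bar>" for n
      by (intro AE_I2) (simp add: indicator_def)
    show "integrable D (\<lambda>u. \<bar>u\<bar>)"
      using integrable_id by simp
  qed measurable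
qed

text \<open>
A level \<open>t\<close> at which \<open>mean_above\<close> is small is easily found far out, but for bounded failure times
the survival function could already be \<open>0\<close> there. Attaining the value \<open>a > 0\<close> exactly, by the
intermediate value theorem, rules this out, because \<open>mean_above t\<close> vanishes with \<open>survival t\<close>.
\<close>

lemma mean_above_attains:
  assumes "0 < a" "a < mean"
  obtains t where "0 \<le> t" "mean_above t = a" "0 < survival t"
proof -
  have "\<forall>\<^sub>F B in at_top. mean_above B < a \<and> 0 \<le> B"
    using order_tendstoD(2)[OF tendsto_mean_above \<open>0 < a\<close>] eventually_ge_at_top[of 0]
    by (rule eventually_conj)
  then obtain B where B: "mean_above B < a" "0 \<le> B"
    using eventually_happens'[OF trivial_limit_at_top_linorder] by blast
  have "\<exists>t. 0 \<le> t \<and> t \<le> B \<and> mean_above t = a"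
    using IVT2[of mean_above B a 0] assms B by (simp add: mean_above_0 isCont_mean_above)
  then obtain t where t: "0 \<le> t" "mean_above t = a" by blast
  then have "survival t \<noteq> 0" using assms mean_above_eq_0[of t] by auto
  moreover have "0 \<le> survival t" by (simp add: survival_def)
  ultimately have "0 < survival t" by simp
  with t show ?thesis by (rule that)
qed

text \<open>
The two moment conditions replace the root \<open>\<gamma>\<close> of \<open>E[exp (\<gamma> U); U \<le> t] = 1\<close>, the exact decay rate.
Expanding the exponential to first order gives \<open>\<gamma>\<close> close to \<open>survival t / mean\<close>; what is needed is
only that a rate slightly below or above this value makes the moment at most or at least \<open>1\<close>.
\<close>

lemma moment_ge_1:
  assumes "0 \<le> \<theta>" "survival t \<le> \<theta> * (mean - mean_above t)"
  shows "1 \<le> (\<integral>\<^sup>+u. indicator {..t} u * ennreal (exp (\<theta> * u)) \<partial>D)"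
proof -
  let ?h = "\<lambda>u. indicator {..t} u + \<theta> * (indicator {..t} u * u)"
  have int: "integrable D ?h"
    by (intro Bochner_Integration.integrable_add integrable_mult_right integrable_indicator_mult_id) auto
  have "(\<integral>u. ?h u \<partial>D) = 1 - survival t + \<theta> * (mean - mean_above t)"
    by (subst Bochner_Integration.integral_add) (auto simp: prob_atMost integral_id_atMost integrable_indicator_mult_id)
  then have "ennreal 1 \<le> ennreal (\<integral>u. ?h u \<partial>D)"
    using assms by (intro ennreal_leI) simp
  also have "\<dots> = (\<integral>\<^sup>+u. ennreal (?h u) \<partial>D)"
    by (rule nn_integral_eq_integral[symmetric, OF int])
       (use nonneg in \<open>eventually_elim, auto simp: indicator_def assms\<close>)
  also have "\<dots> \<le> (\<integral>\<^sup>+u. indicator {..t} u * ennreal (exp (\<theta> * u)) \<partial>D)"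
    by (intro nn_integral_mono) (auto simp: indicator_def intro!: ennreal_leI exp_ge_add_one_self)
  finally show ?thesis by simp
qed

lemma moment_le_1:
  assumes "0 \<le> \<theta>" "0 \<le> t" "\<theta> * exp (\<theta> * t) * mean \<le> survival t"
  shows "(\<integral>\<^sup>+u. indicator {..t} u * ennreal (exp (\<theta> * u)) \<partial>D) \<le> 1"
proof -
  let ?h = "\<lambda>u. indicator {..t} u + \<theta> * exp (\<theta> * t) * u"
  have int: "integrable D ?h"
    by (intro Bochner_Integration.integrable_add integrable_mult_right integrable_id) auto
  have "(\<integral>\<^sup>+u. indicator {..t} u * ennreal (exp (\<theta> * u)) \<partial>D) \<le> (\<integral>\<^sup>+u. ennreal (?h u) \<partial>D)"
  proof (rule nn_integral_mono_AE, use nonneg in eventually_elim)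
    case (elim u)
    show ?case
    proof (cases "u \<le> t")
      case True
      \<comment> \<open>This linear bound yields exp z \<le> 1 + z exp z, linear in u once exp (\<theta> u) is replaced by exp (\<theta> t).\<close>
      have "exp (- (\<theta> * u)) \<ge> 1 - \<theta> * u"
        using exp_ge_add_one_self[of "- (\<theta> * u)"] by simp
      then have "(1 - \<theta> * u) * exp (\<theta> * u) \<le> exp (- (\<theta> * u)) * exp (\<theta> * u)"
        by (intro mult_right_mono) auto
      then have "exp (\<theta> * u) \<le> 1 + \<theta> * u * exp (\<theta> * u)"
        by (simp add: exp_minus algebra_simps)
      also have "\<dots> \<le> 1 + \<theta> * u * exp (\<theta> * t)"
        using elim True assms by (auto intro!: mult_left_mono)
      finally show ?thesis using True by (simp add: mult_ac ennreal_leI)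
    qed simp
  qed
  also have "\<dots> = ennreal (\<integral>u. ?h u \<partial>D)"
    by (rule nn_integral_eq_integral[OF int])
       (use nonneg in \<open>eventually_elim, auto simp: indicator_def assms\<close>)
  also have "(\<integral>u. ?h u \<partial>D) = 1 - survival t + \<theta> * exp (\<theta> * t) * mean"
    by (subst Bochner_Integration.integral_add) (auto simp: prob_atMost mean_def integrable_id)
  also have "ennreal \<dots> \<le> ennreal 1"
    using assms by (intro ennreal_leI) simp
  finally show ?thesis by simp
qed

end

section \<open>Law of the total time\<close>

context restart_model
begin

lemma measurable_T [measurable]: "T \<in> borel_measurable M"
  using distributed_measurable[OF T_density] by simp

lemma measurable_U [measurable]: "U n \<in> borel_measurable M"
  using distributed_measurable[OF U_density[of n]] by simp

abbreviation failure_distr :: "real measure" where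
  "failure_distr \<equiv> distr M borel (U 0)"

lemma distr_U: "distr M borel (U n) = failure_distr"
proof -
  have "distr M borel (U k) = density lborel (\<lambda>t. ennreal (g t))" for k
    using distributed_distr_eq_density[OF U_density[of k]] by (simp cong: distr_cong)
  then show ?thesis by simp
qed

sublocale law: failure_law failure_distr
proof -
  interpret D: prob_space failure_distr
    by (rule prob_space_distr) measurable
  show "failure_law failure_distr"
  proof
    show "AE u in failure_distr. 0 \<le> u"
      using U_nonneg[of 0] by (simp add: AE_distr_iff)
    show "integrable failure_distr (\<lambda>u. u)"
      using integrable_U0 by (simp add: integrable_distr_eq)
    show "0 < (\<integral>u. u \<partial>failure_distr)"
      using mu_pos by (simp add: integral_distr restart_mu_def zero_less_divide_iff)
    show "emeasure failure_distr {a} = 0" for a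
    proof -
      have [measurable]: "(\<lambda>t. ennreal (g t)) \<in> borel_measurable borel"
        using distributed_borel_measurable[OF U_density[of 0]] by simp
      have "failure_distr = density lborel (\<lambda>t. ennreal (g t))"
        using distributed_distr_eq_density[OF U_density[of 0]] by (simp cong: distr_cong)
      then have "emeasure failure_distr {a} = (\<integral>\<^sup>+t. ennreal (g t) * indicator {a} t \<partial>lborel)"
        by (simp add: emeasure_density)
      also have "\<dots> = (\<integral>\<^sup>+t. 0 \<partial>(lborel :: real measure))"
        by (rule nn_integral_cong_AE, use AE_lborel_singleton[of a] in eventually_elim) simp
      finally show ?thesis by simp
    qed
  qed simp
qed

lemma sets_sequence_law [measurable_cong]:
  "sets law.seq.S = sets (\<Pi>\<^sub>M i\<in>(UNIV :: nat set). borel)"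
  by (rule sets_PiM_cong) auto

lemma measurable_failure_sequence [measurable]:
  "(\<lambda>\<omega> i. U (Suc i) \<omega>) \<in> measurable M (\<Pi>\<^sub>M i\<in>(UNIV :: nat set). borel)"
  by (rule measurable_PiM_single') auto

lemma distr_failure_sequence:
  "distr M (\<Pi>\<^sub>M i\<in>(UNIV :: nat set). borel) (\<lambda>\<omega> i. U (Suc i) \<omega>) = law.seq.S"
proof -
  have "indep_vars (\<lambda>j. \<Pi>\<^sub>M i\<in>{Suc (Suc j)}. borel)
      (\<lambda>j \<omega>. restrict (\<lambda>i. case_nat T U i \<omega>) {Suc (Suc j)}) (UNIV :: nat set)"
    by (rule indep_vars_restrict[OF indep]) (auto simp: disjoint_family_on_def)
  then have "indep_vars (\<lambda>_. borel)
      (\<lambda>j \<omega>. (restrict (\<lambda>i. case_nat T U i \<omega>) {Suc (Suc j)}) (Suc (Suc j))) (UNIV :: nat set)"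
    by (rule indep_vars_compose2) simp
  \<comment> \<open>Member j + 2 of the family is U (j + 1).\<close>
  then have "indep_vars (\<lambda>_. borel) (\<lambda>j. U (Suc j)) (UNIV :: nat set)"
    by simp
  moreover have "indep_vars (\<lambda>_. borel) (\<lambda>j. U (Suc j)) (UNIV :: nat set) \<longleftrightarrow>
      distr M (\<Pi>\<^sub>M i\<in>(UNIV :: nat set). borel) (\<lambda>\<omega>. \<lambda>i\<in>UNIV. U (Suc i) \<omega>)
        = (\<Pi>\<^sub>M i\<in>UNIV. distr M borel (U (Suc i)))"
    by (rule indep_vars_iff_distr_eq_PiM) auto
  ultimately show ?thesis
    by (simp add: distr_U[of "Suc _"] restrict_def)
qed

text \<open>
Independence of \<open>T\<close> from the whole sequence comes out of the family \<open>case_nat T U\<close> by splitting the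
index set into \<open>{0}\<close> and \<open>{2..}\<close>; index \<open>1\<close> belongs to the generic failure time \<open>U 0\<close>. Since
\<open>indep_var\<close> relates variables of the same type, \<open>T\<close> is first treated as a function on \<open>{0}\<close> and then
evaluated.
\<close>

lemma joint_distr:
  "distr M (borel \<Otimes>\<^sub>M (\<Pi>\<^sub>M i\<in>(UNIV :: nat set). borel)) (\<lambda>\<omega>. (T \<omega>, \<lambda>i. U (Suc i) \<omega>))
     = distr M borel T \<Otimes>\<^sub>M law.seq.S"
proof -
  let ?B = "{2..} :: nat set"
  have "indep_var (\<Pi>\<^sub>M i\<in>{0::nat}. borel) (\<lambda>\<omega>. restrict (\<lambda>i. case_nat T U i \<omega>) {0})
      (\<Pi>\<^sub>M i\<in>?B. borel) (\<lambda>\<omega>. restrict (\<lambda>i. case_nat T U i \<omega>) ?B)"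
    by (rule indep_var_restrict[OF indep]) auto
  then have indep: "indep_var (\<Pi>\<^sub>M i\<in>{0::nat}. borel) (id \<circ> (\<lambda>\<omega>. restrict (\<lambda>i. case_nat T U i \<omega>) {0}))
      (\<Pi>\<^sub>M i\<in>(UNIV :: nat set). borel)
      ((\<lambda>h i. h (Suc (Suc i))) \<circ> (\<lambda>\<omega>. restrict (\<lambda>i. case_nat T U i \<omega>) ?B))"
    by (rule indep_var_compose) (auto intro!: measurable_PiM_single' simp: space_PiM)
  let ?Q = "\<Pi>\<^sub>M i\<in>{0::nat}. borel :: real measure"
  let ?P = "\<Pi>\<^sub>M i\<in>(UNIV :: nat set). borel :: real measure"
  let ?X = "\<lambda>\<omega>. restrict (\<lambda>i. case_nat T U i \<omega>) {0}"
  have [measurable]: "?X \<in> measurable M ?Q"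
    by (rule measurable_restrict) auto
  have "distr M ?Q ?X \<Otimes>\<^sub>M law.seq.S = distr M (?Q \<Otimes>\<^sub>M ?P) (\<lambda>\<omega>. (?X \<omega>, \<lambda>i. U (Suc i) \<omega>))"
    using indep unfolding indep_var_distribution_eq
    by (simp add: comp_def distr_failure_sequence)
  then have "distr (distr M ?Q ?X \<Otimes>\<^sub>M law.seq.S) (borel \<Otimes>\<^sub>M ?P) (\<lambda>(h, u). (h 0, u))
      = distr M (borel \<Otimes>\<^sub>M ?P) (\<lambda>\<omega>. (T \<omega>, \<lambda>i. U (Suc i) \<omega>))"
    by (simp add: distr_distr comp_def)
  moreover have "distr (distr M ?Q ?X \<Otimes>\<^sub>M law.seq.S) (borel \<Otimes>\<^sub>M ?P) (\<lambda>(h, u). (h 0, u))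
      = distr (distr M ?Q ?X) borel (\<lambda>h. h 0) \<Otimes>\<^sub>M distr law.seq.S ?P (\<lambda>u. u)"
    by (rule pair_measure_distr[symmetric])
       (auto intro!: prob_space_imp_sigma_finite law.seq.P.prob_space_distr simp: measurable_ident_sets sets_sequence_law)
  moreover have "distr (distr M ?Q ?X) borel (\<lambda>h. h 0) = distr M borel T"
    by (simp add: distr_distr comp_def)
  moreover have "distr law.seq.S ?P (\<lambda>u. u) = law.seq.S"
    by (rule distr_id2) (simp add: sets_sequence_law)
  ultimately show ?thesis by simp
qed

definition truncated_time :: "nat \<Rightarrow> 'a \<Rightarrow> real" where
  "truncated_time n \<omega> = T \<omega> + failed_time n (T \<omega>) (\<lambda>i. U (Suc i) \<omega>)"

lemma measurable_truncated_time [measurable]: "truncated_time n \<in> borel_measurable M"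
  unfolding truncated_time_def by measurable

text \<open>
This is conditioning on \<open>T\<close>: given \<open>T = t\<close>, the failed attempts have to take longer than \<open>x - t\<close>.
\<close>

lemma emeasure_truncated_time:
  "emeasure M {\<omega> \<in> space M. x < truncated_time n \<omega>} = (\<integral>\<^sup>+\<omega>. law.failed_tail n (T \<omega>) (x - T \<omega>) \<partial>M)"
proof -
  let ?P = "\<Pi>\<^sub>M i\<in>(UNIV :: nat set). borel :: real measure"
  let ?h = "\<lambda>p. fst p + failed_time n (fst p) (snd p)"
  interpret DT: prob_space "distr M borel T"
    by (rule prob_space_distr) measurable
  have [measurable]: "?h \<in> borel_measurable (borel \<Otimes>\<^sub>M ?P)"
    by measurable
  have "emeasure M {\<omega> \<in> space M. x < truncated_time n \<omega>}
      = emeasure (distr M (borel \<Otimes>\<^sub>M ?P) (\<lambda>\<omega>. (T \<omega>, \<lambda>i. U (Suc i) \<omega>)))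
          {p \<in> space (borel \<Otimes>\<^sub>M ?P). x < ?h p}"
    by (subst emeasure_distr, measurable)
       (auto intro!: arg_cong2[where f = emeasure] simp: truncated_time_def space_pair_measure space_PiM)
  also have "\<dots> = (\<integral>\<^sup>+t. emeasure law.seq.S (Pair t -` {p \<in> space (borel \<Otimes>\<^sub>M ?P). x < ?h p}) \<partial>distr M borel T)"
    unfolding joint_distr
    by (rule law.seq.P.emeasure_pair_measure_alt) measurable
  also have "\<dots> = (\<integral>\<^sup>+t. law.failed_tail n t (x - t) \<partial>distr M borel T)"
    by (intro nn_integral_cong)
       (auto simp: law.failed_tail_def space_pair_measure space_PiM algebra_simps
         intro!: arg_cong2[where f = emeasure])
  also have "\<dots> = (\<integral>\<^sup>+\<omega>. law.failed_tail n (T \<omega>) (x - T \<omega>) \<partial>M)"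
    by (rule nn_integral_distr) measurable
  finally show ?thesis .
qed

text \<open>
The failure time \<open>U (Suc j)\<close> enters \<open>S\<close> exactly if the first \<open>Suc j\<close> attempts fail. In this form \<open>S\<close> is a
series of measurable functions and its partial sums are failed times.
\<close>

lemma restart_S_eq:
  "restart_S T U \<omega> = (\<Sum>j. if \<forall>k\<le>j. U (Suc k) \<omega> \<le> T \<omega> then ennreal (U (Suc j) \<omega>) else 0)"
proof -
  have N: "enat (Suc j) \<le> restart_N T U \<omega> \<longleftrightarrow> (\<forall>k\<le>j. U (Suc k) \<omega> \<le> T \<omega>)" for j
  proof -
    have "enat (Suc j) \<le> restart_N T U \<omega> \<longleftrightarrow> (\<forall>k. T \<omega> < U (Suc k) \<omega> \<longrightarrow> Suc j \<le> k)"
      unfolding restart_N_def le_Inf_iff by auto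
    then show ?thesis by (auto simp: not_less_eq_eq[symmetric] not_less[symmetric])
  qed
  let ?F = "\<lambda>i. if 1 \<le> i \<and> enat i \<le> restart_N T U \<omega> then ennreal (U i \<omega>) else 0"
  have "(\<lambda>i. ?F (Suc i)) sums (\<Sum>i. ?F (Suc i))"
    by (rule summable_sums) simp
  from sums_Suc[OF this] have "(\<Sum>i. ?F i) = (\<Sum>i. ?F (Suc i))"
    by (intro sums_unique[symmetric]) simp
  then show ?thesis by (simp add: restart_S_def N)
qed

lemma measurable_restart_X [measurable]: "restart_X T U \<in> borel_measurable M"
  unfolding restart_X_def[abs_def] restart_S_eq by measurable

lemma restart_X_eq_SUP:
  assumes "0 \<le> T \<omega>" "\<And>n. 0 \<le> U n \<omega>"
  shows "restart_X T U \<omega> = (SUP n. ennreal (truncated_time n \<omega>))"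
proof -
  have "ennreal (failed_time n (T \<omega>) (\<lambda>i. U (Suc i) \<omega>))
      = (\<Sum>j<n. ennreal (if \<forall>k\<le>j. U (Suc k) \<omega> \<le> T \<omega> then U (Suc j) \<omega> else 0))" for n
    unfolding failed_time_def by (rule sum_ennreal[symmetric]) (simp add: assms)
  then have "ennreal (failed_time n (T \<omega>) (\<lambda>i. U (Suc i) \<omega>))
      = (\<Sum>j<n. if \<forall>k\<le>j. U (Suc k) \<omega> \<le> T \<omega> then ennreal (U (Suc j) \<omega>) else 0)" for n
    by (simp add: if_distrib[of ennreal] cong: if_cong)
  moreover have "0 \<le> failed_time n (T \<omega>) (\<lambda>i. U (Suc i) \<omega>)" for n
    unfolding failed_time_def by (intro sum_nonneg) (simp add: assms)
  ultimately show ?thesis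
    by (simp add: restart_X_def restart_S_eq suminf_eq_SUP truncated_time_def assms ennreal_SUP_add_right)
qed

lemma AE_nonneg: "AE \<omega> in M. 0 \<le> T \<omega> \<and> (\<forall>n. 0 \<le> U n \<omega>)"
  using T_nonneg U_nonneg by (simp add: AE_all_countable)

lemma less_restart_X_iff:
  assumes "0 \<le> T \<omega> \<and> (\<forall>n. 0 \<le> U n \<omega>)" "0 \<le> x"
  shows "ennreal x < restart_X T U \<omega> \<longleftrightarrow> (\<exists>n. x < truncated_time n \<omega>)"
  using assms by (simp add: restart_X_eq_SUP less_SUP_iff ennreal_less_iff)

lemma emeasure_truncated_time_le:
  assumes "0 \<le> x"
  shows "emeasure M {\<omega> \<in> space M. x < truncated_time n \<omega>} \<le> ennreal (restart_Hbar M T U x)"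
  unfolding restart_Hbar_def emeasure_eq_measure[symmetric]
  by (rule emeasure_mono_AE)
     (use AE_nonneg in \<open>eventually_elim, auto simp: less_restart_X_iff assms\<close>, measurable)

text \<open>
Almost surely, the truncated times increase to \<open>X\<close>, so this is continuity of the measure from below.
\<close>

lemma restart_Hbar_le_of_truncated:
  assumes "0 \<le> x" and le: "\<And>n. emeasure M {\<omega> \<in> space M. x < truncated_time n \<omega>} \<le> b"
  shows "ennreal (restart_Hbar M T U x) \<le> b"
proof -
  define A where "A n = {\<omega> \<in> space M. (0 \<le> T \<omega> \<and> (\<forall>n. 0 \<le> U n \<omega>)) \<and> x < truncated_time n \<omega>}" for n
  have meas: "range A \<subseteq> sets M"
    unfolding A_def by auto
  have mono: "truncated_time n \<omega> \<le> truncated_time (Suc n) \<omega>" if "\<forall>n. 0 \<le> U n \<omega>" for n \<omega>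
    using that by (simp add: truncated_time_def failed_time_def)
  have "incseq A"
    by (rule incseq_SucI) (auto simp: A_def intro: less_le_trans[OF _ mono])
  have "ennreal (restart_Hbar M T U x) = emeasure M (\<Union>n. A n)"
    unfolding restart_Hbar_def emeasure_eq_measure[symmetric]
  proof (rule emeasure_eq_AE)
    show "AE \<omega> in M. \<omega> \<in> {\<omega> \<in> space M. ennreal x < restart_X T U \<omega>} \<longleftrightarrow> \<omega> \<in> (\<Union>n. A n)"
      using AE_nonneg
    proof eventually_elim
      case (elim \<omega>)
      then show ?case by (auto simp: A_def less_restart_X_iff[OF _ \<open>0 \<le> x\<close>])
    qed
  qed (use meas in auto)
  also have "\<dots> = (SUP n. emeasure M (A n))"
    by (rule SUP_emeasure_incseq[symmetric]) fact+
  also have "\<dots> \<le> b"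
    by (intro SUP_least order_trans[OF emeasure_mono le]) (auto simp: A_def)
  finally show ?thesis .
qed

lemma restart_Gbar_eq: "restart_Gbar M U t = law.survival t"
  unfolding restart_Gbar_def law.survival_def
  by (subst measure_distr) (auto intro!: arg_cong2[where f = measure])

lemma restart_mu_eq: "restart_mu M U = 1 / law.mean"
  unfolding restart_mu_def law.mean_def by (subst integral_distr) auto

section \<open>The approximating integrals\<close>

text \<open>
With \<open>\<kappa> = \<mu> (1 \<plusminus> \<epsilon>)\<close> this is \<open>I\<^sub>\<plusminus>(x, \<epsilon>)\<close>; see \<open>approximant_density\<close>.
\<close>

definition approximant :: "real \<Rightarrow> real \<Rightarrow> real" where
  "approximant \<kappa> x = expectation (\<lambda>\<omega>. exp (- (\<kappa> * law.survival (T \<omega>) * x)))"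

lemma integrable_approximant: "integrable M (\<lambda>\<omega>. exp (- (\<kappa> * law.survival (T \<omega>) * x)))"
proof (rule integrable_const_bound[where B = "exp (\<bar>\<kappa>\<bar> * \<bar>x\<bar>)"])
  have "\<bar>\<kappa> * law.survival t * x\<bar> \<le> \<bar>\<kappa>\<bar> * \<bar>x\<bar>" for t
    using law.survival_nonneg[of t] law.survival_le_1[of t]
    by (simp add: abs_mult mult_right_le_one_le mult_right_mono)
  then have "- (\<kappa> * law.survival t * x) \<le> \<bar>\<kappa>\<bar> * \<bar>x\<bar>" for t
    using abs_ge_minus_self order_trans by blast
  then show "AE \<omega> in M. norm (exp (- (\<kappa> * law.survival (T \<omega>) * x))) \<le> exp (\<bar>\<kappa>\<bar> * \<bar>x\<bar>)"
    by simp
qed measurable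

lemma approximant_density:
  "(LINT t:{0..}|lborel. exp (- (restart_mu M U * restart_Gbar M U t * x * c)) * f t)
     = approximant (c / law.mean) x"
proof -
  let ?h = "\<lambda>t. exp (- (c / law.mean * law.survival t * x))"
  have "(LINT t:{0..}|lborel. exp (- (restart_mu M U * restart_Gbar M U t * x * c)) * f t)
      = (\<integral>t. f t * (indicator {0..} t * ?h t) \<partial>lborel)"
    unfolding set_lebesgue_integral_def restart_Gbar_eq restart_mu_eq
    by (intro Bochner_Integration.integral_cong) (simp_all add: mult_ac)
  also have "\<dots> = expectation (\<lambda>\<omega>. indicator {0..} (T \<omega>) * ?h (T \<omega>))"
    by (rule distributed_integral[OF T_density]) (auto simp: f_nonneg)
  also have "\<dots> = approximant (c / law.mean) x"
    unfolding approximant_def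
    by (rule integral_cong_AE) (use T_nonneg in auto)
  finally show ?thesis .
qed

text \<open>
Otherwise the nonnegative variable \<open>T\<close> would have its support in a bounded interval.
\<close>

lemma prob_T_ge_pos: "0 < prob {\<omega> \<in> space M. b \<le> T \<omega>}"
proof (rule ccontr)
  assume "\<not> 0 < prob {\<omega> \<in> space M. b \<le> T \<omega>}"
  then have 0: "prob {\<omega> \<in> space M. b \<le> T \<omega>} = 0"
    using measure_nonneg[of M "{\<omega> \<in> space M. b \<le> T \<omega>}"] by linarith
  have "measure_support (distr M borel T) \<subseteq> {0..b}"
  proof
    fix t assume t: "t \<in> measure_support (distr M borel T)"
    show "t \<in> {0..b}"
    proof (rule ccontr)
      assume "t \<notin> {0..b}"
      then consider "t \<in> {..<0}" | "t \<in> {b<..}" by force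
      then show False
      proof cases
        case 1
        then have "0 < emeasure (distr M borel T) {..<0}"
          using t by (auto simp: measure_support_def)
        also have "\<dots> = emeasure M {\<omega> \<in> space M. T \<omega> < 0}"
          by (subst emeasure_distr) (auto intro!: arg_cong2[where f = emeasure])
        also have "\<dots> = 0"
          using T_nonneg by (subst emeasure_eq_0_AE) (auto simp: not_less)
        finally show False by simp
      next
        case 2
        then have "0 < emeasure (distr M borel T) {b<..}"
          using t by (auto simp: measure_support_def)
        also have "\<dots> = emeasure M {\<omega> \<in> space M. b < T \<omega>}"
          by (subst emeasure_distr) (auto intro!: arg_cong2[where f = emeasure])
        also have "\<dots> \<le> emeasure M {\<omega> \<in> space M. b \<le> T \<omega>}"
          by (intro emeasure_mono) auto
        finally show False using 0 by (simp add: emeasure_eq_measure)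
      qed
    qed
  qed
  then have "bounded (measure_support (distr M borel T))"
    by (rule bounded_subset[OF bounded_closed_interval])
  with T_unbounded show False by simp
qed

lemma approximant_ge:
  assumes "0 \<le> \<kappa>" "0 \<le> x"
  shows "exp (- (\<kappa> * law.survival b * x)) * prob {\<omega> \<in> space M. b \<le> T \<omega>} \<le> approximant \<kappa> x"
proof -
  have "exp (- (\<kappa> * law.survival b * x)) * prob {\<omega> \<in> space M. b \<le> T \<omega>}
      = expectation (\<lambda>\<omega>. exp (- (\<kappa> * law.survival b * x)) * indicator {\<omega> \<in> space M. b \<le> T \<omega>} \<omega>)"
    by simp
  also have "\<dots> \<le> approximant \<kappa> x"
    unfolding approximant_def
  proof (intro integral_mono integrable_approximant)
    fix \<omega> assume "\<omega> \<in> space M"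
    show "exp (- (\<kappa> * law.survival b * x)) * indicator {\<omega> \<in> space M. b \<le> T \<omega>} \<omega>
        \<le> exp (- (\<kappa> * law.survival (T \<omega>) * x))"
    proof (cases "b \<le> T \<omega>")
      case True
      then have "\<kappa> * law.survival (T \<omega>) * x \<le> \<kappa> * law.survival b * x"
        using assms by (intro mult_right_mono mult_left_mono law.survival_antimono)
      then show ?thesis by (auto simp: indicator_def)
    qed simp
  qed (auto simp: emeasure_eq_measure)
  finally show ?thesis .
qed

lemma approximant_pos: "0 \<le> \<kappa> \<Longrightarrow> 0 \<le> x \<Longrightarrow> 0 < approximant \<kappa> x"
  by (rule less_le_trans[OF _ approximant_ge[where b = 0]]) (simp_all add: prob_T_ge_pos)

text \<open>
Task times below \<open>s\<close> contribute at most \<open>exp (- \<kappa> survival(s) x)\<close>. Far out there is a \<open>b\<close> with a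
strictly smaller survival probability, and task times above \<open>b\<close> have positive probability and decay
at the slower rate \<open>\<kappa> survival(b)\<close>, so they dominate.
\<close>

lemma exp_rate_negligible:
  assumes "0 < \<kappa>" "0 < law.survival s"
  shows "((\<lambda>x. exp (- (\<kappa> * law.survival s * x)) / approximant \<kappa> x) \<longlongrightarrow> 0) at_top"
proof -
  obtain b where b: "law.survival b < law.survival s"
    using eventually_happens'[OF trivial_limit_at_top_linorder order_tendstoD(2)[OF law.tendsto_survival assms(2)]]
    by blast
  define p where "p = prob {\<omega> \<in> space M. b \<le> T \<omega>}"
  define \<eta> where "\<eta> = \<kappa> * (law.survival s - law.survival b)"
  have "0 < p" unfolding p_def by (rule prob_T_ge_pos)
  have "0 < \<eta>" using assms b by (simp add: \<eta>_def)
  show ?thesis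
  proof (rule tendsto_sandwich[OF _ _ tendsto_const])
    show "\<forall>\<^sub>F x in at_top. exp (- (\<kappa> * law.survival s * x)) / approximant \<kappa> x \<le> exp (- (\<eta> * x)) / p"
      using eventually_ge_at_top[of 0]
    proof eventually_elim
      case (elim x)
      have "exp (- (\<kappa> * law.survival s * x)) / approximant \<kappa> x
          \<le> exp (- (\<kappa> * law.survival s * x)) / (exp (- (\<kappa> * law.survival b * x)) * p)"
        using assms elim \<open>0 < p\<close> approximant_ge[of \<kappa> x b] by (intro divide_left_mono) (auto simp: p_def approximant_pos)
      also have "\<dots> = exp (- (\<eta> * x)) / p"
        by (simp add: \<eta>_def exp_minus exp_diff field_simps flip: exp_add)
      finally show ?case .
    qed
    show "\<forall>\<^sub>F x in at_top. 0 \<le> exp (- (\<kappa> * law.survival s * x)) / approximant \<kappa> x"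
      using eventually_ge_at_top[of 0]
      by eventually_elim (use assms in \<open>simp add: approximant_pos less_imp_le\<close>)
    show "((\<lambda>x. exp (- (\<eta> * x)) / p) \<longlongrightarrow> 0) at_top"
      using \<open>0 < \<eta>\<close> \<open>0 < p\<close> by real_asymp
  qed
qed

section \<open>Comparison of the tail with the integrals\<close>

lemma nn_integral_approximant:
  "(\<integral>\<^sup>+\<omega>. ennreal (exp (- (\<kappa> * law.survival (T \<omega>) * x))) \<partial>M) = ennreal (approximant \<kappa> x)"
  unfolding approximant_def by (intro nn_integral_eq_integral integrable_approximant) simp

text \<open>
For task times \<open>t \<ge> s\<close> the third hypothesis gives the moment condition of \<open>failed_tail_ge\<close> with
\<open>\<theta> = \<kappa> survival(t)\<close>. At the level \<open>x - t\<close> the overshoot \<open>t\<close> cancels against the task time, so the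
integrand is bounded without any constant factor. Task times below \<open>s\<close> are absorbed in the last term.
\<close>

lemma approximant_le_restart_Hbar:
  assumes "0 \<le> \<kappa>" "0 \<le> s" "1 \<le> \<kappa> * (law.mean - law.mean_above s)" "0 \<le> x"
  shows "approximant \<kappa> x \<le> restart_Hbar M T U x + exp (- (\<kappa> * law.survival s * x))"
proof -
  let ?e = "\<lambda>t. exp (- (\<kappa> * law.survival t * x))"
  have Hbar_nonneg: "0 \<le> restart_Hbar M T U x" by (simp add: restart_Hbar_def)
  have tail: "ennreal (?e t) \<le> law.failed_tail n t (x - t) + ennreal (exp x * law.discount ^ n + ?e s)"
    if "0 \<le> t" for n t
  proof (cases "s \<le> t")
    case True
    have "1 \<le> \<kappa> * (law.mean - law.mean_above t)"
      using assms(3) mult_left_mono[OF law.mean_above_antimono[OF \<open>0 \<le> s\<close> True] \<open>0 \<le> \<kappa>\<close>]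
      by (simp add: algebra_simps)
    then have "law.survival t * 1 \<le> law.survival t * (\<kappa> * (law.mean - law.mean_above t))"
      by (intro mult_left_mono law.survival_nonneg)
    then have "1 \<le> (\<integral>\<^sup>+u. indicator {..t} u * ennreal (exp (\<kappa> * law.survival t * u)) \<partial>failure_distr)"
      using \<open>0 \<le> \<kappa>\<close> law.survival_nonneg by (intro law.moment_ge_1) (auto simp: mult_ac)
    from law.failed_tail_ge[OF _ this, of "x - t" n]
    have "ennreal (?e t) \<le> law.failed_tail n t (x - t) + ennreal (exp (x - t) * law.discount ^ n)"
      using assms law.survival_nonneg by simp
    also have "\<dots> \<le> law.failed_tail n t (x - t) + ennreal (exp x * law.discount ^ n + ?e s)"
      using that by (intro add_left_mono ennreal_leI add_increasing2 mult_right_mono)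
        (auto simp: law.discount_nonneg)
    finally show ?thesis .
  next
    case False
    then have "?e t \<le> ?e s"
      using assms by (simp add: law.survival_antimono mult_left_mono mult_right_mono)
    then have "ennreal (?e t) \<le> ennreal (exp x * law.discount ^ n + ?e s)"
      by (intro ennreal_leI add_increasing) (auto simp: law.discount_nonneg)
    then show ?thesis by (rule add_increasing[rotated]) simp
  qed
  have bound: "approximant \<kappa> x \<le> restart_Hbar M T U x + (exp x * law.discount ^ n + ?e s)" for n
  proof -
    have "ennreal (approximant \<kappa> x)
        \<le> (\<integral>\<^sup>+\<omega>. law.failed_tail n (T \<omega>) (x - T \<omega>) + ennreal (exp x * law.discount ^ n + ?e s) \<partial>M)"
      unfolding nn_integral_approximant[symmetric]
      by (rule nn_integral_mono_AE, use T_nonneg in eventually_elim) (rule tail)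
    also have "\<dots> = emeasure M {\<omega> \<in> space M. x < truncated_time n \<omega>} + ennreal (exp x * law.discount ^ n + ?e s)"
      by (subst nn_integral_add) (auto simp: emeasure_truncated_time emeasure_space_1)
    also have "\<dots> \<le> ennreal (restart_Hbar M T U x) + ennreal (exp x * law.discount ^ n + ?e s)"
      by (intro add_right_mono emeasure_truncated_time_le assms)
    finally show ?thesis
      by (simp add: ennreal_le_iff law.discount_nonneg Hbar_nonneg flip: ennreal_plus)
  qed
  have "(\<lambda>n. restart_Hbar M T U x + (exp x * law.discount ^ n + ?e s))
      \<longlonglongrightarrow> restart_Hbar M T U x + (exp x * 0 + ?e s)"
    by (intro tendsto_intros LIMSEQ_realpow_zero law.discount_nonneg law.discount_less_1)
  from LIMSEQ_le_const[OF this] bound show ?thesis by auto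
qed

text \<open>
Here \<open>failed_tail_le\<close> at the level \<open>x - t\<close> leaves a factor \<open>exp (\<theta> t)\<close>, for \<open>\<theta> = \<kappa> survival(t)\<close>. By
\<open>survival_le_mean_above\<close> and the hypothesis on \<open>mean_above s\<close> it is at most \<open>1 + \<delta>\<close> for \<open>t \<ge> s\<close>. A task time
below \<open>s\<close> is treated with the rate that belongs to \<open>s\<close>: the moment condition at \<open>s\<close> implies the one
at any smaller truncation level. Task times larger than \<open>x\<close> are covered because
\<open>failed_tail_le\<close> also holds at negative levels.
\<close>

lemma restart_Hbar_le_approximant:
  assumes "0 \<le> \<kappa>" "0 \<le> s" "0 < \<delta>" "0 \<le> x"
    and excess: "\<kappa> * law.mean_above s \<le> ln (1 + \<delta>)" and rate: "\<kappa> * (1 + \<delta>) * law.mean \<le> 1"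
  shows "restart_Hbar M T U x \<le> (1 + \<delta>) * (approximant \<kappa> x + exp (- (\<kappa> * law.survival s * x)))"
proof -
  let ?e = "\<lambda>t. exp (- (\<kappa> * law.survival t * x))"
  let ?moment = "\<lambda>\<theta> t. \<integral>\<^sup>+u. indicator {..t} u * ennreal (exp (\<theta> * u)) \<partial>failure_distr"
  have late: "exp (\<kappa> * law.survival t * t) \<le> 1 + \<delta>" "?moment (\<kappa> * law.survival t) t \<le> 1"
    if "s \<le> t" for t
  proof -
    have "0 \<le> t" using that assms by simp
    have "\<kappa> * (law.survival t * t) \<le> \<kappa> * law.mean_above s"
      using law.survival_le_mean_above[OF \<open>0 \<le> t\<close>] law.mean_above_antimono[OF \<open>0 \<le> s\<close> that]
      by (intro mult_left_mono \<open>0 \<le> \<kappa>\<close>) simp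
    with excess have "\<kappa> * law.survival t * t \<le> ln (1 + \<delta>)" by (simp add: mult_ac)
    with \<open>0 < \<delta>\<close> show *: "exp (\<kappa> * law.survival t * t) \<le> 1 + \<delta>"
      by (simp add: ln_ge_iff)
    have "\<kappa> * law.survival t * exp (\<kappa> * law.survival t * t) * law.mean
        \<le> \<kappa> * law.survival t * (1 + \<delta>) * law.mean"
      using assms law.survival_nonneg law.mean_pos
      by (intro mult_right_mono mult_left_mono *) auto
    also have "\<dots> = law.survival t * (\<kappa> * (1 + \<delta>) * law.mean)"
      by (simp add: mult_ac)
    also have "\<dots> \<le> law.survival t * 1"
      by (intro mult_left_mono rate law.survival_nonneg)
    finally show "?moment (\<kappa> * law.survival t) t \<le> 1"
      using assms law.survival_nonneg \<open>0 \<le> t\<close> by (intro law.moment_le_1) auto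
  qed
  have tail: "law.failed_tail n t (x - t) \<le> ennreal ((1 + \<delta>) * (?e t + ?e s))" if "0 \<le> t" for n t
  proof -
    \<comment> \<open>The rate used for the task time t is the one that belongs to r.\<close>
    define r where "r = max s t"
    have r: "s \<le> r" "t \<le> r" by (simp_all add: r_def)
    let ?\<theta> = "\<kappa> * law.survival r"
    have \<theta>: "0 \<le> ?\<theta>" using assms law.survival_nonneg by simp
    have "?moment ?\<theta> t \<le> ?moment ?\<theta> r"
      using r by (intro nn_integral_mono) (auto simp: indicator_def)
    also have "\<dots> \<le> 1" by (rule late) fact
    finally have "law.failed_tail n t (x - t) \<le> ennreal (exp (- ?\<theta> * (x - t)))"
      by (rule law.failed_tail_le[OF \<theta>])
    also have "exp (- ?\<theta> * (x - t)) = exp (?\<theta> * t) * ?e r"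
      by (simp add: algebra_simps flip: exp_add)
    also have "\<dots> \<le> (1 + \<delta>) * (?e t + ?e s)"
    proof (intro mult_mono)
      have "exp (?\<theta> * t) \<le> exp (?\<theta> * r)" using \<theta> r by (simp add: mult_left_mono)
      also have "\<dots> \<le> 1 + \<delta>" by (rule late) fact
      finally show "exp (?\<theta> * t) \<le> 1 + \<delta>" .
      show "?e r \<le> ?e t + ?e s" by (auto simp: r_def max_def)
    qed (use \<open>0 < \<delta>\<close> in auto)
    finally show ?thesis by (simp add: ennreal_leI)
  qed
  have "ennreal (restart_Hbar M T U x) \<le> (\<integral>\<^sup>+\<omega>. ennreal ((1 + \<delta>) * (?e (T \<omega>) + ?e s)) \<partial>M)"
  proof (rule restart_Hbar_le_of_truncated[OF \<open>0 \<le> x\<close>])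
    fix n
    show "emeasure M {\<omega> \<in> space M. x < truncated_time n \<omega>} \<le> (\<integral>\<^sup>+\<omega>. ennreal ((1 + \<delta>) * (?e (T \<omega>) + ?e s)) \<partial>M)"
      unfolding emeasure_truncated_time
      by (rule nn_integral_mono_AE, use T_nonneg in eventually_elim) (rule tail)
  qed
  also have "\<dots> = ennreal (expectation (\<lambda>\<omega>. (1 + \<delta>) * (?e (T \<omega>) + ?e s)))"
    using \<open>0 < \<delta>\<close> by (intro nn_integral_eq_integral) (auto intro: integrable_approximant)
  also have "expectation (\<lambda>\<omega>. (1 + \<delta>) * (?e (T \<omega>) + ?e s)) = (1 + \<delta>) * (approximant \<kappa> x + ?e s)"
    by (simp add: approximant_def Bochner_Integration.integral_add[OF integrable_approximant] prob_space)
  finally show ?thesis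
    using \<open>0 < \<delta>\<close> approximant_pos[OF \<open>0 \<le> \<kappa>\<close> \<open>0 \<le> x\<close>] by (simp add: ennreal_le_iff)
qed

section \<open>Limits of the ratios\<close>

lemma Liminf_ratio_ge:
  assumes "0 < \<epsilon>"
  shows "ereal (1 - \<epsilon>) \<le> Liminf at_top (\<lambda>x. ereal (restart_Hbar M T U x / restart_I_plus M U f x \<epsilon>))"
proof (rule Liminf_bounded)
  define \<kappa> where "\<kappa> = (1 + \<epsilon>) / law.mean"
  have "0 < \<kappa>" using assms law.mean_pos by (simp add: \<kappa>_def)
  \<comment> \<open>This is the largest value of mean_above s that approximant_le_restart_Hbar allows; it exceeds 0
    since 1 / \<kappa> = mean / (1 + \<epsilon>).\<close>
  obtain s where s: "0 \<le> s" "law.mean_above s = law.mean - 1 / \<kappa>" "0 < law.survival s"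
  proof (rule law.mean_above_attains)
    show "0 < law.mean - 1 / \<kappa>" "law.mean - 1 / \<kappa> < law.mean"
      using assms law.mean_pos by (simp_all add: \<kappa>_def field_simps)
  qed
  have I: "restart_I_plus M U f x \<epsilon> = approximant \<kappa> x" for x
    unfolding restart_I_plus_def \<kappa>_def by (rule approximant_density)
  have "\<forall>\<^sub>F x in at_top. exp (- (\<kappa> * law.survival s * x)) / approximant \<kappa> x < \<epsilon>"
    using exp_rate_negligible[OF \<open>0 < \<kappa>\<close> s(3)] assms by (rule order_tendstoD)
  then show "\<forall>\<^sub>F x in at_top. ereal (1 - \<epsilon>) \<le> ereal (restart_Hbar M T U x / restart_I_plus M U f x \<epsilon>)"
    using eventually_ge_at_top[of 0]
  proof eventually_elim
    case (elim x)
    have pos: "0 < approximant \<kappa> x" using \<open>0 < \<kappa>\<close> elim by (intro approximant_pos) auto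
    have "approximant \<kappa> x \<le> restart_Hbar M T U x + exp (- (\<kappa> * law.survival s * x))"
      using \<open>0 < \<kappa>\<close> s elim by (intro approximant_le_restart_Hbar) auto
    with elim pos show ?case
      by (simp add: I field_simps)
  qed
qed

lemma Limsup_ratio_le:
  assumes "0 < \<epsilon>"
  shows "Limsup at_top (\<lambda>x. ereal (restart_Hbar M T U x / restart_I_minus M U f x \<epsilon>)) \<le> ereal (1 + \<epsilon>)"
proof (rule Limsup_bounded)
  define \<kappa> where "\<kappa> = (1 - \<epsilon>) / law.mean"
  have I: "restart_I_minus M U f x \<epsilon> = approximant \<kappa> x" for x
    unfolding restart_I_minus_def \<kappa>_def by (rule approximant_density)
  show "\<forall>\<^sub>F x in at_top. ereal (restart_Hbar M T U x / restart_I_minus M U f x \<epsilon>) \<le> ereal (1 + \<epsilon>)"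
  proof (cases "\<epsilon> < 1")
    case False
    show ?thesis
      using eventually_ge_at_top[of 0]
    proof eventually_elim
      case (elim x)
      \<comment> \<open>For \<epsilon> \<ge> 1 the exponent in the integral is nonnegative, and the ratio is at most 1.\<close>
      have "\<kappa> \<le> 0" using False law.mean_pos by (simp add: \<kappa>_def divide_nonpos_pos)
      then have "0 \<le> - (\<kappa> * law.survival t * x)" for t
        using elim law.survival_nonneg[of t] by (simp add: mult_nonpos_nonneg)
      then have "expectation (\<lambda>_. 1) \<le> approximant \<kappa> x"
        unfolding approximant_def by (intro integral_mono integrable_approximant) auto
      then have "1 \<le> approximant \<kappa> x" by (simp add: prob_space)
      moreover have "restart_Hbar M T U x \<le> 1" by (simp add: restart_Hbar_def)
      ultimately have "restart_Hbar M T U x / approximant \<kappa> x \<le> 1" by simp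
      then show ?case using assms by (simp add: I)
    qed
  next
    case True
    \<comment> \<open>Half of \<epsilon> goes into the factor of the main term, the rest into the negligible term.\<close>
    define \<delta> where "\<delta> = \<epsilon> / 2"
    have "0 < \<kappa>" using True law.mean_pos by (simp add: \<kappa>_def)
    have "0 < \<delta>" using assms by (simp add: \<delta>_def)
    obtain s where s: "0 \<le> s" "law.mean_above s = min (ln (1 + \<delta>) / \<kappa>) (law.mean / 2)" "0 < law.survival s"
    proof (rule law.mean_above_attains)
      show "0 < min (ln (1 + \<delta>) / \<kappa>) (law.mean / 2)" "min (ln (1 + \<delta>) / \<kappa>) (law.mean / 2) < law.mean"
        using \<open>0 < \<kappa>\<close> \<open>0 < \<delta>\<close> law.mean_pos by auto
    qed
    have "\<kappa> * law.mean_above s \<le> \<kappa> * (ln (1 + \<delta>) / \<kappa>)"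
      using \<open>0 < \<kappa>\<close> unfolding s(2) by (intro mult_left_mono) auto
    then have excess: "\<kappa> * law.mean_above s \<le> ln (1 + \<delta>)" using \<open>0 < \<kappa>\<close> by simp
    have "(1 - \<epsilon>) * (1 + \<delta>) \<le> 1"
      using assms by (simp add: \<delta>_def algebra_simps)
    then have rate: "\<kappa> * (1 + \<delta>) * law.mean \<le> 1"
      using law.mean_pos by (simp add: \<kappa>_def)
    have "(1 + \<delta>) * (1 + \<delta> / (1 + \<delta>)) = 1 + \<epsilon>"
      using \<open>0 < \<delta>\<close> by (simp add: \<delta>_def field_simps)
    have "\<forall>\<^sub>F x in at_top. exp (- (\<kappa> * law.survival s * x)) / approximant \<kappa> x < \<delta> / (1 + \<delta>)"
      using exp_rate_negligible[OF \<open>0 < \<kappa>\<close> s(3)] \<open>0 < \<delta>\<close> by (intro order_tendstoD) auto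
    then show ?thesis
      using eventually_ge_at_top[of 0]
    proof eventually_elim
      case (elim x)
      have pos: "0 < approximant \<kappa> x" using \<open>0 < \<kappa>\<close> elim by (intro approximant_pos) auto
      have "restart_Hbar M T U x \<le> (1 + \<delta>) * (approximant \<kappa> x + exp (- (\<kappa> * law.survival s * x)))"
        using \<open>0 < \<kappa>\<close> \<open>0 < \<delta>\<close> s elim excess rate by (intro restart_Hbar_le_approximant) auto
      then have "restart_Hbar M T U x / approximant \<kappa> x
          \<le> (1 + \<delta>) * (1 + exp (- (\<kappa> * law.survival s * x)) / approximant \<kappa> x)"
        using pos by (simp add: field_simps)
      also have "\<dots> \<le> (1 + \<delta>) * (1 + \<delta> / (1 + \<delta>))"
        using elim \<open>0 < \<delta>\<close> by (intro mult_left_mono) auto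
      also have "\<dots> = 1 + \<epsilon>" by fact
      finally show ?case by (simp add: I)
    qed
  qed
qed

end

theorem lemma1p1:
  fixes M :: "'a measure" and T :: "'a \<Rightarrow> real" and U :: "nat \<Rightarrow> 'a \<Rightarrow> real"
    and f g :: "real \<Rightarrow> real" and \<epsilon> :: real
  assumes "restart_model M T U f g" and "0 < \<epsilon>"
  shows "ereal (1 - \<epsilon>)
           \<le> Liminf at_top (\<lambda>x::real. ereal (restart_Hbar M T U x / restart_I_plus M U f x \<epsilon>))
       \<and> Limsup at_top (\<lambda>x::real. ereal (restart_Hbar M T U x / restart_I_minus M U f x \<epsilon>))
           \<le> ereal (1 + \<epsilon>)"
  using restart_model.Liminf_ratio_ge[OF assms] restart_model.Limsup_ratio_le[OF assms] by simp

end
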